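(* Let $n\geq 2$ and let $p(z)=z^n+a_{n-1}z^{n-1}+a_{n-2}z^{n-2}+\cdots+a_1z+a_0$ be a monic polynomial of degree $n$ with complex coefficients $a_0,a_1,\ldots,a_{n-1}$. Let $\lambda\in\mathbb{C}$ be any zero of $p(z)$. Then $$|\lambda|\leq\frac{1}{2}\left(|a_{n-1}|+\cos\left(\frac{\pi}{n}\right)\right)+\frac{1}{2}\sqrt{\left(|a_{n-1}|-\cos\left(\frac{\pi}{n}\right)\right)^2+2\left(1+\sum_{i=0}^{n-2}|a_i|^2\right)}.$$ *)

theory Defs
  imports Complex_Main "HOL-Computational_Algebra.Polynomial"
begin

end

theory Submission
  imports Defs "HOL-Analysis.L2_Norm"
begin

text \<open>
  The bound is a numerical radius estimate for the companion matrix of \<open>p\<close>, applied to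
  its eigenvector \<open>(1, z, \<dots>, z ^ (n - 1))\<close>. Split that vector into its last entry, of
  modulus \<open>t\<close>, and the remaining entries, of Euclidean norm \<open>u\<close>. The rest of the matrix
  acts on the latter as the \<open>(n - 1)\<close>-dimensional shift, whose numerical radius is
  \<open>cos (pi / n)\<close>; this enters through the lemma \<open>path_quadratic_form_le\<close>. The two off-diagonal blocks have norms \<open>1\<close> and \<open>b\<close>, where
  \<open>b\<^sup>2\<close> is the sum of the \<open>(cmod (coeff p i))\<^sup>2\<close> with \<open>i \<le> n - 2\<close>. Writing \<open>a\<close> for the
  modulus of the coefficient of degree \<open>n - 1\<close> and \<open>c\<close> for the cosine, this gives
  \<open>cmod z * (t\<^sup>2 + u\<^sup>2) \<le> a * t\<^sup>2 + c * u\<^sup>2 + (1 + b) * t * u\<close>.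
  Hence \<open>cmod z\<close> is at most the larger eigenvalue of a symmetric \<open>2 \<times> 2\<close> matrix
  (\<open>binary_form_eigenvalue_bound\<close>), and \<open>(1 + b)\<^sup>2 \<le> 2 * (1 + b\<^sup>2)\<close> turns that
  eigenvalue into the stated bound.

  Since the eigenvector consists of powers of \<open>z\<close>, everything can be done with the real
  number \<open>cmod z\<close>: the only input from the polynomial is the triangle inequality
  \<open>monic_root_power_le\<close>.
\<close>

text \<open>
  Products of neighbouring entries are split by the weighted arithmetic-geometric mean
  inequality, with weight \<open>s (k + 1) / s k\<close> on \<open>(v k)\<^sup>2\<close> and its inverse on
  \<open>(v (k + 1))\<^sup>2\<close>, where
  \<open>s k = sin ((k + 1) * \<theta>)\<close>. The recurrence \<open>s (k - 1) + s (k + 1) = 2 * cos \<theta> * s k\<close> makes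
  the weights at every inner position add up to \<open>2 * cos \<theta>\<close>. The subtracted term is the
  weight that the last position has not yet received; the next step of the induction
  uses it up.
\<close>
lemma path_quadratic_form_partial:
  fixes v :: "nat \<Rightarrow> real" and \<theta> :: real
  assumes "\<And>k. k \<le> m \<Longrightarrow> sin (real (k + 1) * \<theta>) > 0"
  shows "2 * (\<Sum>k<m. v k * v (k + 1)) \<le> 2 * cos \<theta> * (\<Sum>k\<le>m. (v k)\<^sup>2)
    - sin (real (m + 2) * \<theta>) / sin (real (m + 1) * \<theta>) * (v m)\<^sup>2"
  using assms
proof (induction m)
  case 0
  have "sin \<theta> > 0" using "0.prems"[of 0] by simp
  then show ?case by (simp add: sin_double)
next
  case (Suc m)
  define s where "s k = sin (real (k + 1) * \<theta>)" for k
  have pos: "s m > 0" "s (Suc m) > 0" using Suc.prems[of m] Suc.prems[of "Suc m"]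
    by (simp_all add: s_def)
  have rec: "s m + s (m + 2) = 2 * cos \<theta> * s (Suc m)"
  proof -
    have e: "real (m + 1) * \<theta> = real (m + 2) * \<theta> - \<theta>" "real (m + 3) * \<theta> = real (m + 2) * \<theta> + \<theta>"
      by (simp_all add: algebra_simps)
    have "sin (real (m + 1) * \<theta>) + sin (real (m + 3) * \<theta>) = 2 * cos \<theta> * sin (real (m + 2) * \<theta>)"
      unfolding e sin_add sin_diff by simp
    then show ?thesis by (simp add: s_def add.commute)
  qed
  have weight: "s m / s (Suc m) = 2 * cos \<theta> - s (m + 2) / s (Suc m)"
    using rec pos by (simp add: field_simps)
  have "0 \<le> (s (Suc m) * v m - s m * v (Suc m))\<^sup>2 / (s m * s (Suc m))"
    using pos by simp
  also have "\<dots> = s (Suc m) / s m * (v m)\<^sup>2 + s m / s (Suc m) * (v (Suc m))\<^sup>2 - 2 * (v m * v (Suc m))"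
    using pos by (simp add: field_simps power2_eq_square)
  finally have amgm: "2 * (v m * v (Suc m)) \<le>
      s (Suc m) / s m * (v m)\<^sup>2 + (2 * cos \<theta> - s (m + 2) / s (Suc m)) * (v (Suc m))\<^sup>2"
    unfolding weight by simp
  have IH: "2 * (\<Sum>k<m. v k * v (k + 1)) \<le> 2 * cos \<theta> * (\<Sum>k\<le>m. (v k)\<^sup>2) - s (Suc m) / s m * (v m)\<^sup>2"
    using Suc.IH Suc.prems by (simp add: s_def)
  have "2 * (\<Sum>k<Suc m. v k * v (k + 1)) \<le>
      2 * cos \<theta> * (\<Sum>k\<le>Suc m. (v k)\<^sup>2) - s (m + 2) / s (Suc m) * (v (Suc m))\<^sup>2"
    using IH amgm by (simp add: algebra_simps)
  then show ?case by (simp add: s_def)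
qed

text \<open>
  For the angle \<open>pi / (m + 2)\<close> the sines stay positive at the positions \<open>0, \<dots>, m\<close>
  and vanish at the next one, so nothing is left to subtract.
\<close>
lemma path_quadratic_form_le:
  fixes v :: "nat \<Rightarrow> real"
  shows "(\<Sum>k<m. v k * v (k + 1)) \<le> cos (pi / real (m + 2)) * (\<Sum>k\<le>m. (v k)\<^sup>2)"
proof -
  define \<theta> where "\<theta> = pi / real (m + 2)"
  have "sin (real (k + 1) * \<theta>) > 0" if "k \<le> m" for k
  proof (rule sin_gt_zero)
    show "0 < real (k + 1) * \<theta>" by (simp add: \<theta>_def)
    have "real (k + 1) * \<theta> < real (m + 2) * \<theta>"
      using that by (intro mult_strict_right_mono) (auto simp: \<theta>_def)
    then show "real (k + 1) * \<theta> < pi" by (simp add: \<theta>_def)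
  qed
  from path_quadratic_form_partial[OF this, of m v]
  have "2 * (\<Sum>k<m. v k * v (k + 1)) \<le> 2 * cos \<theta> * (\<Sum>k\<le>m. (v k)\<^sup>2)
      - sin (real (m + 2) * \<theta>) / sin (real (m + 1) * \<theta>) * (v m)\<^sup>2" by simp
  moreover have "real (m + 2) * \<theta> = pi" by (simp add: \<theta>_def)
  ultimately show ?thesis by (simp add: \<theta>_def)
qed

text \<open>
  With \<open>d = b\<^sup>2\<close> the right-hand side is the larger eigenvalue of the symmetric matrix with
  diagonal \<open>a\<close>, \<open>c\<close> and off-diagonal entries \<open>b / 2\<close>. If \<open>r\<close> exceeded it, then
  \<open>r - a > 0\<close> and \<open>4 * (r - a) * (r - c) > b\<^sup>2\<close>, so
  \<open>(r - a) * t\<^sup>2 - b * t * u + (r - c) * u\<^sup>2\<close> would be positive definite.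
\<close>
lemma binary_form_eigenvalue_bound:
  fixes a b c d r t u :: real
  assumes form: "r * (t\<^sup>2 + u\<^sup>2) \<le> a * t\<^sup>2 + c * u\<^sup>2 + b * t * u"
    and d: "b\<^sup>2 \<le> d" and u: "u \<noteq> 0"
  shows "r \<le> (1 / 2) * (a + c) + (1 / 2) * sqrt ((a - c)\<^sup>2 + d)"
proof (rule ccontr)
  define q where "q = sqrt ((a - c)\<^sup>2 + d)"
  assume "\<not> ?thesis"
  then have "\<not> r \<le> (1 / 2) * (a + c) + (1 / 2) * q" unfolding q_def .
  then have gt: "2 * r - a - c > q" by argo
  have d0: "d \<ge> 0" using d zero_le_power2[of b] by linarith
  have "sqrt ((a - c)\<^sup>2) \<le> q" unfolding q_def using d0 by (intro real_sqrt_le_mono) simp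
  then have q_ge: "\<bar>a - c\<bar> \<le> q" by simp
  have ra: "r - a > 0" using gt q_ge by linarith
  have "q\<^sup>2 < (2 * r - a - c)\<^sup>2"
    using gt q_ge by (intro power_strict_mono) auto
  moreover have "q\<^sup>2 = (a - c)\<^sup>2 + d" using d0 by (simp add: q_def)
  ultimately have disc: "4 * (r - a) * (r - c) - b\<^sup>2 > 0"
    using d by (simp add: power2_eq_square algebra_simps)
  have "0 < (4 * (r - a) * (r - c) - b\<^sup>2) * u\<^sup>2" using disc u by simp
  also have "\<dots> \<le> (2 * (r - a) * t - b * u)\<^sup>2 + (4 * (r - a) * (r - c) - b\<^sup>2) * u\<^sup>2" by simp
  also have "\<dots> = 4 * (r - a) * (r * (t\<^sup>2 + u\<^sup>2) - (a * t\<^sup>2 + c * u\<^sup>2 + b * t * u))"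
    by (simp add: power2_eq_square algebra_simps)
  also have "\<dots> \<le> 0" using ra form by (intro mult_nonneg_nonpos) auto
  finally show False by simp
qed

lemma monic_root_power_le:
  fixes p :: "'a::{real_normed_div_algebra, comm_ring_1} poly"
  assumes "lead_coeff p = 1" and "poly p z = 0"
  shows "norm z ^ degree p \<le> (\<Sum>i<degree p. norm (coeff p i) * norm z ^ i)"
proof -
  have "(\<Sum>i<degree p. coeff p i * z ^ i) + z ^ degree p = 0"
    using assms by (simp add: poly_altdef lessThan_Suc_atMost[symmetric])
  then have "z ^ degree p = - (\<Sum>i<degree p. coeff p i * z ^ i)"
    by (metis add.commute eq_neg_iff_add_eq_0)
  then have "norm (z ^ degree p) = norm (\<Sum>i<degree p. coeff p i * z ^ i)" by simp
  also have "\<dots> \<le> (\<Sum>i<degree p. norm (coeff p i * z ^ i))" by (rule norm_sum)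
  finally show ?thesis by (simp add: norm_mult norm_power)
qed

theorem theorem3p4:
  fixes n :: nat and p :: "complex poly" and z :: complex
  assumes "n \<ge> 2"
    and "degree p = n"
    and "lead_coeff p = 1"
    and "poly p z = 0"
  shows "cmod z \<le> (1 / 2) * (cmod (coeff p (n - 1)) + cos (pi / real n))
    + (1 / 2) * sqrt ((cmod (coeff p (n - 1)) - cos (pi / real n))\<^sup>2
        + 2 * (1 + (\<Sum>i = 0..n - 2. (cmod (coeff p i))\<^sup>2)))"
proof -
  obtain m where n: "n = m + 2" using assms(1) by (metis le_add_diff_inverse2)
  define r where "r = cmod z"
  define a where "a = cmod (coeff p (m + 1))"
  define c where "c = cos (pi / real n)"
  define b where "b = L2_set (\<lambda>i. cmod (coeff p i)) {..m}"
  define t where "t = r ^ (m + 1)"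
  define u where "u = L2_set (\<lambda>i. r ^ i) {..m}"
  have r0: "r \<ge> 0" by (simp add: r_def)
  have t0: "t \<ge> 0" using r0 by (simp add: t_def)
  have b2: "b\<^sup>2 = (\<Sum>i\<le>m. (cmod (coeff p i))\<^sup>2)"
    by (simp add: b_def L2_set_def sum_nonneg)
  have u2: "u\<^sup>2 = (\<Sum>i\<le>m. (r ^ i)\<^sup>2)"
    by (simp add: u_def L2_set_def sum_nonneg)
  \<comment> \<open>The entry \<open>z ^ 0 = 1\<close> keeps \<open>u\<close> away from zero even when \<open>z = 0\<close>.\<close>
  have u_ge: "r ^ i \<le> u" if "i \<le> m" for i
    unfolding u_def using that r0 by (intro member_le_L2_set) auto
  have "u \<noteq> 0" using u_ge[of 0] by auto

  have "(\<Sum>i\<le>m. cmod (coeff p i) * r ^ i) \<le> b * u"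
    unfolding b_def u_def
    using L2_set_mult_ineq[of "\<lambda>i. cmod (coeff p i)" "\<lambda>i. r ^ i" "{..m}"] r0 by simp
  moreover have "r * t \<le> (\<Sum>i\<le>m. cmod (coeff p i) * r ^ i) + a * t"
    using monic_root_power_le[OF assms(3,4)] assms(2)
    by (simp add: n r_def a_def t_def lessThan_Suc_atMost)
  ultimately have "r * t \<le> a * t + b * u" by linarith
  then have "r * t * t \<le> (a * t + b * u) * t" using t0 by (rule mult_right_mono)
  then have last_entry: "r * t\<^sup>2 \<le> a * t\<^sup>2 + b * t * u"
    by (simp add: power2_eq_square algebra_simps)

  have "r * u\<^sup>2 = (\<Sum>k<Suc m. r ^ k * r ^ (k + 1))"
    unfolding u2 lessThan_Suc_atMost
    by (simp add: sum_distrib_left power2_eq_square algebra_simps)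
  also have "\<dots> = (\<Sum>k<m. r ^ k * r ^ (k + 1)) + r ^ m * t" by (simp add: t_def)
  also have "\<dots> \<le> c * u\<^sup>2 + u * t"
    using path_quadratic_form_le[of "\<lambda>k. r ^ k" m] mult_right_mono[OF u_ge[of m] t0]
    by (simp add: u2 c_def n)
  finally have "r * (t\<^sup>2 + u\<^sup>2) \<le> a * t\<^sup>2 + c * u\<^sup>2 + (1 + b) * t * u"
    using last_entry by (simp add: algebra_simps)
  moreover have "(1 + b)\<^sup>2 \<le> 2 * (1 + b\<^sup>2)"
    using zero_le_power2[of "1 - b"] by (simp add: power2_eq_square algebra_simps)
  ultimately have "r \<le> (1 / 2) * (a + c) + (1 / 2) * sqrt ((a - c)\<^sup>2 + 2 * (1 + b\<^sup>2))"
    using \<open>u \<noteq> 0\<close> by (rule binary_form_eigenvalue_bound)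
  then show ?thesis
    by (simp add: r_def a_def c_def b2 n atLeast0AtMost)
qed

end
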